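(* Assume that the penalty factor is constant, i.e. $\rho_n=\rho$ for all $n\ge 1$, with $\rho\in(0,1]$. Let $x^*_\rho$ be the unique zero in $(0,1)$ of the function $$h_\rho(x)=\pi x(1-x)+\rho\left(-(1-p_A)x^2+(1-p_B)(1-x)^2\right),\qquad 0\le x\le 1.$$ Then $X_n\to x^*_\rho$ almost surely as $n\to\infty$.
   Context: Let $0<p_B\le p_A<1$ and $\pi=p_A-p_B$. Let $(\gamma_n)_{n\ge 1}$ be a non-increasing sequence of positive numbers with $\gamma_n<1$, $\sum_{n\ge 1}\gamma_n=+\infty$ and $\sum_{n}e^{-\vartheta/\gamma_n}<\infty$ for every $\vartheta>0$. Let $(\rho_n)_{n\ge 1}$ be a sequence of positive numbers with $\gamma_n\rho_n<1$. Let $(U_n)_{n\ge 1}$ be i.i.d. random variables uniformly distributed on $[0,1]$, and let $A_n,B_n$ ($n\ge1$) be events with $\mathbb{P}(A_n)=p_A$, $\mathbb{P}(B_n)=p_B$, such that the pairs $(\mathbf 1_{A_n},\mathbf 1_{B_n})$, $n\ge 1$, are independent of one another and the sequence $(\mathbf 1_{A_n},\mathbf 1_{B_n})_{n\ge1}$ is independent of $(U_n)_{n\ge1}$. The penalized two-armed bandit algorithm is the $[0,1]$-valued sequence $(X_n)_{n\ge0}$ with $X_0=x\in(0,1)$ and $$X_{n+1}=X_n+\gamma_{n+1}\left(\mathbf 1_{\{U_{n+1}\le X_n\}\cap A_{n+1}}(1-X_n)-\mathbf 1_{\{U_{n+1}>X_n\}\cap B_{n+1}}X_n\right)-\gamma_{n+1}\rho_{n+1}\left(X_n\mathbf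 1_{\{U_{n+1}\le X_n\}\cap A_{n+1}^c}-(1-X_n)\mathbf 1_{\{U_{n+1}>X_n\}\cap B_{n+1}^c}\right),\quad n\ge0.$$ *)

theory Defs
  imports "HOL-Probability.Probability"
begin

text \<open>
  Time-indexed families (\<open>\<gamma>\<close>, \<open>\<rho>\<close>, \<open>U\<close>, \<open>A\<close>, \<open>B\<close>) are only used at indices \<open>n \<ge> 1\<close>;
  their value at \<open>0\<close> is irrelevant.
\<close>

primrec bandit ::
  "(nat \<Rightarrow> real) \<Rightarrow> (nat \<Rightarrow> real) \<Rightarrow> (nat \<Rightarrow> 'a \<Rightarrow> real) \<Rightarrow> (nat \<Rightarrow> 'a set) \<Rightarrow> (nat \<Rightarrow> 'a set)
    \<Rightarrow> real \<Rightarrow> nat \<Rightarrow> 'a \<Rightarrow> real" where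
  "bandit \<gamma> \<rho> U A B x 0 = (\<lambda>\<omega>. x)"
| "bandit \<gamma> \<rho> U A B x (Suc n) = (\<lambda>\<omega>.
     let X = bandit \<gamma> \<rho> U A B x n in
     X \<omega>
     + \<gamma> (Suc n) * (indicator ({w. U (Suc n) w \<le> X w} \<inter> A (Suc n)) \<omega> * (1 - X \<omega>)
                    - indicator ({w. U (Suc n) w > X w} \<inter> B (Suc n)) \<omega> * X \<omega>)
     - \<gamma> (Suc n) * \<rho> (Suc n) * (X \<omega> * indicator ({w. U (Suc n) w \<le> X w} \<inter> - A (Suc n)) \<omega>
                    - (1 - X \<omega>) * indicator ({w. U (Suc n) w > X w} \<inter> - B (Suc n)) \<omega>))"

definition bandit_drift :: "real \<Rightarrow> real \<Rightarrow> real \<Rightarrow> real \<Rightarrow> real" where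
  "bandit_drift pA pB \<rho> x =
     (pA - pB) * x * (1 - x) + \<rho> * (- (1 - pA) * x\<^sup>2 + (1 - pB) * (1 - x)\<^sup>2)"

definition arm_indicators ::
  "(nat \<Rightarrow> 'a set) \<Rightarrow> (nat \<Rightarrow> 'a set) \<Rightarrow> nat \<Rightarrow> 'a \<Rightarrow> real \<times> real" where
  "arm_indicators A B n \<omega> = (indicator (A n) \<omega>, indicator (B n) \<omega>)"

text \<open>
  The library constant \<open>prob_space.indep_var\<close> forces both random variables to have values in the
  same type. For variables of different types we express independence as independence of the
  generated \<open>\<sigma>\<close>-algebras. The algebra \<open>vimage_algebra (space M) X S\<close> is the one generated by \<open>X\<close>.
\<close>

definition indep_rvs ::
  "'a measure \<Rightarrow> 'b measure \<Rightarrow> ('a \<Rightarrow> 'b) \<Rightarrow> 'c measure \<Rightarrow> ('a \<Rightarrow> 'c) \<Rightarrow> bool" where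
  "indep_rvs M S X T Y \<longleftrightarrow>
     X \<in> measurable M S \<and> Y \<in> measurable M T \<and>
     prob_space.indep_set M (sets (vimage_algebra (space M) X S))
                            (sets (vimage_algebra (space M) Y T))"

end

theory Submission
  imports Defs
begin

text \<open>
  Write \<open>h\<close> for the drift \<open>bandit_drift pA pB \<rho>\<close> and \<open>z\<close> for its zero. The recursion has the form
  \<open>X\<^sub>n\<^sub>+\<^sub>1 = X\<^sub>n + \<gamma>\<^sub>n\<^sub>+\<^sub>1 F(X\<^sub>n, Z\<^sub>n\<^sub>+\<^sub>1)\<close>, where \<open>Z\<^sub>n\<^sub>+\<^sub>1\<close> (the uniform variable together with the two arm
  indicators) is independent of the past, \<open>\<bar>F\<bar> \<le> 1\<close>, and \<open>F(x, Z\<^sub>n\<^sub>+\<^sub>1)\<close> has mean \<open>h(x)\<close>.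
  So it is a noisy Euler scheme for the differential equation \<open>x' = h(x)\<close>.

  The drift is a polynomial of degree at most two with \<open>h(0) > 0 > h(1)\<close>. Dividing by \<open>x - z\<close> leaves
  an affine function, which is negative at both endpoints of \<open>[0,1]\<close> and hence bounded away from \<open>0\<close>
  on it: \<open>h(x) = - k(x) (x - z)\<close> with \<open>\<kappa> \<le> k(x) \<le> K\<close> (\<open>bandit_drift_mean_reversion\<close>).
  The flow therefore contracts to \<open>z\<close> at an exponential rate, and only the noise has to be controlled.

  The squares of the steps \<open>\<gamma>\<^sub>n\<close> may fail to be summable, so \<open>L\<^sup>2\<close> martingale convergence is not
  applicable. The hypothesis on \<open>exp (- \<theta> / \<gamma>\<^sub>n)\<close> fits an exponential inequality instead. Fix \<open>\<delta> > 0\<close>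
  and cut time into blocks, each the shortest one whose steps add up to at least \<open>\<delta>\<close>. The steps being
  non-increasing, the sum of their squares over a block is at most \<open>\<delta> + 1\<close> times its first step
  \<open>\<gamma>\<close>. The Azuma-Hoeffding bound then says that the noise of the block exceeds \<open>\<delta>\<^sup>2\<close>
  with probability at most \<open>2 exp (- \<theta> / \<gamma>)\<close>, for some \<open>\<theta>\<close> depending on \<open>\<delta>\<close> only. Distinct blocks
  begin at distinct indices, so these bounds are summable, and by Borel-Cantelli almost surely
  all but finitely many blocks have noise at most \<open>\<delta>\<^sup>2\<close> (\<open>AE_block_noise_small\<close>).

  The rest is deterministic. Inside a late block \<open>X\<close> moves by at most \<open>2 \<delta>\<close>, so replacing
  \<open>h(X\<^sub>i)\<close> by its value at the start of the block costs \<open>O(\<delta>\<^sup>2)\<close> over the block. One block thus maps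
  the distance \<open>d\<close> to \<open>z\<close> to at most \<open>(1 - \<kappa> \<delta>) d + O(\<delta>\<^sup>2)\<close>, whence
  \<open>limsup \<bar>X\<^sub>n - z\<bar> = O(\<delta>)\<close>. Letting \<open>\<delta>\<close> tend to \<open>0\<close> along \<open>1 / (m + 1)\<close> gives the convergence
  (\<open>mean_reverting_recursion_tendsto\<close>). The noise enters only through its total over each block:
  at the intermediate times the sum of the steps alone keeps \<open>X\<close> close to where the block began.
\<close>

section \<open>The drift and its zero\<close>

text \<open>
  The quotient \<open>k\<close> of the drift by \<open>z - x\<close> is affine in \<open>x\<close>, and the boundary signs of the drift make
  it positive at \<open>0\<close> and at \<open>1\<close>; its values on \<open>[0,1]\<close> lie between these two.
\<close>
lemma bandit_drift_mean_reversion: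
  fixes pA pB \<rho> :: real
  assumes "0 < pB" "pB \<le> pA" "pA < 1" "0 < \<rho>" "\<rho> \<le> 1"
  obtains z \<kappa> K where "z \<in> {0<..<1}" "0 < \<kappa>"
    "\<And>x. x \<in> {0..1} \<Longrightarrow> \<exists>k\<in>{\<kappa>..K}. bandit_drift pA pB \<rho> x = - k * (x - z)"
proof -
  let ?h = "bandit_drift pA pB \<rho>"
  have h0: "?h 0 > 0" and h1: "?h 1 < 0"
    using assms by (auto simp: bandit_drift_def mult_pos_neg)
  have "continuous_on {0..1} ?h"
    unfolding bandit_drift_def by (intro continuous_intros)
  then obtain z where z: "0 \<le> z" "z \<le> 1" "?h z = 0"
    using IVT2'[of ?h 1 0 0] h0 h1 by auto
  then have z01: "z \<in> {0<..<1}"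
    using h0 h1 by (metis greaterThanLessThan_iff less_irrefl order_le_less)
  define k where "k x = (pA - pB) * (1 - \<rho>) * (x + z) - ((pA - pB) - 2 * \<rho> * (1 - pB))" for x
  have fac: "?h x = - k x * (x - z)" for x
  proof -
    have "?h x = ?h x - ?h z" using z by simp
    also have "\<dots> = - k x * (x - z)"
      unfolding bandit_drift_def k_def by algebra
    finally show ?thesis .
  qed
  have k0: "k 0 > 0" and k1: "k 1 > 0"
    using fac[of 0] fac[of 1] h0 h1 z01 by (auto simp: zero_less_mult_iff)
  show thesis
  proof (rule that[OF z01])
    show "0 < min (k 0) (k 1)" using k0 k1 by simp
    fix x :: real assume x: "x \<in> {0..1}"
    have "k x = k 0 + x * (k 1 - k 0)" "k x = k 1 - (1 - x) * (k 1 - k 0)"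
      unfolding k_def by algebra+
    moreover have "0 \<le> x * max 0 (k 1 - k 0)" "0 \<le> (1 - x) * max 0 (k 1 - k 0)"
       "x * min 0 (k 1 - k 0) \<le> 0" "(1 - x) * min 0 (k 1 - k 0) \<le> 0"
      using x by (auto intro!: mult_nonneg_nonneg mult_nonneg_nonpos)
    ultimately have "k x \<in> {min (k 0) (k 1)..max (k 0) (k 1)}"
      by (cases "k 1 \<ge> k 0") (auto simp: min_def max_def split: if_splits)
    then show "\<exists>k\<in>{min (k 0) (k 1)..max (k 0) (k 1)}. ?h x = - k * (x - z)"
      using fac by blast
  qed
qed

lemma bandit_drift_lipschitz:
  fixes pA pB \<rho> :: real
  assumes "0 < pB" "pB \<le> pA" "pA < 1" "0 < \<rho>" "\<rho> \<le> 1" "x \<in> {0..1}" "y \<in> {0..1}"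
  shows "\<bar>bandit_drift pA pB \<rho> x - bandit_drift pA pB \<rho> y\<bar> \<le> 4 * \<bar>x - y\<bar>"
proof -
  let ?c = "(pA - pB) * (1 - \<rho>) * (x + y) - ((pA - pB) - 2 * \<rho> * (1 - pB))"
  have "bandit_drift pA pB \<rho> x - bandit_drift pA pB \<rho> y = - ?c * (x - y)"
    unfolding bandit_drift_def by algebra
  moreover have "\<bar>?c\<bar> \<le> 4"
  proof -
    have "0 \<le> (pA - pB) * (1 - \<rho>)" "(pA - pB) * (1 - \<rho>) \<le> 1"
      using assms by (auto intro: mult_le_one)
    then have "0 \<le> (pA - pB) * (1 - \<rho>) * (x + y)" "(pA - pB) * (1 - \<rho>) * (x + y) \<le> 1 * 2"
      using assms by (auto simp only: atLeastAtMost_iff intro!: mult_nonneg_nonneg mult_mono)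
    moreover have "0 \<le> \<rho> * (1 - pB)" "\<rho> * (1 - pB) \<le> 1"
      using assms by (auto intro: mult_le_one)
    ultimately show ?thesis using assms by linarith
  qed
  ultimately show ?thesis by (simp add: abs_mult mult_right_mono)
qed

section \<open>Mean-reverting recursions with small block noise\<close>

text \<open>
  Consecutive blocks of indices, the \<open>j\<close>-th being \<open>{block g \<delta> j..<block g \<delta> (Suc j)}\<close>. In the clock
  that advances by \<open>g i\<close> at step \<open>i\<close>, each lasts \<open>\<delta>\<close> up to an overshoot by its last step.
\<close>
primrec block :: "(nat \<Rightarrow> real) \<Rightarrow> real \<Rightarrow> nat \<Rightarrow> nat" where
  "block g \<delta> 0 = 0"
| "block g \<delta> (Suc j) = (LEAST n. \<delta> \<le> (\<Sum>i\<in>{block g \<delta> j..<n}. g i))"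

lemma block_properties:
  fixes g :: "nat \<Rightarrow> real"
  assumes div: "filterlim (\<lambda>n. \<Sum>i<n. g i) at_top sequentially" and "0 < \<delta>"
  shows block_sum_ge: "\<delta> \<le> (\<Sum>i\<in>{block g \<delta> j..<block g \<delta> (Suc j)}. g i)"
    and block_sum_less: "n < block g \<delta> (Suc j) \<Longrightarrow> (\<Sum>i\<in>{block g \<delta> j..<n}. g i) < \<delta>"
    and block_less: "block g \<delta> j < block g \<delta> (Suc j)"
proof -
  let ?P = "\<lambda>n. \<delta> \<le> (\<Sum>i\<in>{block g \<delta> j..<n}. g i)"
  have "\<forall>\<^sub>F n in sequentially. \<delta> + (\<Sum>i<block g \<delta> j. g i) \<le> (\<Sum>i<n. g i) \<and> block g \<delta> j \<le> n"
    using div eventually_ge_at_top[of "block g \<delta> j"]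
    by (auto simp: filterlim_at_top intro: eventually_conj)
  then obtain n where n: "\<delta> + (\<Sum>i<block g \<delta> j. g i) \<le> (\<Sum>i<n. g i)" "block g \<delta> j \<le> n"
    by (auto simp: eventually_sequentially)
  have "?P n"
    using n sum_diff_nat_ivl[of 0 "block g \<delta> j" n g] by (simp add: atLeast0LessThan)
  then show *: "?P (block g \<delta> (Suc j))" by (simp del: sum.cong) (rule LeastI[of ?P])
  show "n < block g \<delta> (Suc j) \<Longrightarrow> (\<Sum>i\<in>{block g \<delta> j..<n}. g i) < \<delta>" for n
    using not_less_Least[of n ?P] by auto
  show "block g \<delta> j < block g \<delta> (Suc j)"
    using * \<open>0 < \<delta>\<close> by (rule_tac ccontr) (simp del: block.simps)
qed

lemma block_strict_mono:
  assumes "filterlim (\<lambda>n. \<Sum>i<n. (g :: nat \<Rightarrow> real) i) at_top sequentially" "0 < \<delta>"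
  shows "strict_mono (block g \<delta>)"
  by (rule strict_mono_Suc_iff[THEN iffD2]) (use block_less[OF assms] in blast)

lemma block_sum_le:
  fixes g :: "nat \<Rightarrow> real"
  assumes "filterlim (\<lambda>n. \<Sum>i<n. g i) at_top sequentially" "0 < \<delta>"
    and "\<And>i. block g \<delta> j \<le> i \<Longrightarrow> g i \<le> b"
  shows "(\<Sum>i\<in>{block g \<delta> j..<block g \<delta> (Suc j)}. g i) \<le> \<delta> + b"
proof -
  let ?N = "block g \<delta> j" and ?N' = "block g \<delta> (Suc j)"
  have less: "?N < ?N'" by (rule block_less[OF assms(1,2)])
  then obtain m where m: "?N' = Suc m" "?N \<le> m"
    by (metis less_Suc_eq_le not0_implies_Suc not_less0)
  have "(\<Sum>i\<in>{?N..<?N'}. g i) = (\<Sum>i\<in>{?N..<m}. g i) + g m"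
    using m by simp
  also have "\<dots> \<le> \<delta> + b"
    using block_sum_less[OF assms(1,2), of m j] m assms(3)[of m] by simp
  finally show ?thesis .
qed

lemma contraction_eventually_le:
  fixes a :: "nat \<Rightarrow> real"
  assumes step: "\<And>j. j \<ge> J \<Longrightarrow> a (Suc j) \<le> (1 - q) * a j + q * B"
    and q: "0 < q" "q \<le> 1" and "0 < e"
  shows "\<forall>\<^sub>F j in sequentially. a j \<le> B + e"
proof -
  have bound: "a (J + n) - B \<le> (1 - q) ^ n * (a J - B)" for n
  proof (induction n)
    case (Suc n)
    have "a (J + Suc n) - B \<le> (1 - q) * (a (J + n) - B)"
      using step[of "J + n"] by (simp add: algebra_simps)
    also have "\<dots> \<le> (1 - q) * ((1 - q) ^ n * (a J - B))"
      using Suc q by (intro mult_left_mono) auto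
    finally show ?case by (simp add: mult.assoc)
  qed simp
  have "(\<lambda>n. (1 - q) ^ n * (a J - B)) \<longlonglongrightarrow> 0 * (a J - B)"
    using q by (intro tendsto_mult LIMSEQ_power_zero tendsto_const) auto
  then have "\<forall>\<^sub>F n in sequentially. (1 - q) ^ n * (a J - B) < e"
    using \<open>0 < e\<close> by (intro order_tendstoD(2)[of _ "0 * (a J - B)"]) auto
  then obtain n0 where n0: "\<And>n. n \<ge> n0 \<Longrightarrow> (1 - q) ^ n * (a J - B) < e"
    by (auto simp: eventually_sequentially)
  show ?thesis
    unfolding eventually_sequentially
  proof (intro exI allI impI)
    fix j assume "J + n0 \<le> j"
    then show "a j \<le> B + e"
      using bound[of "j - J"] n0[of "j - J"] by (simp add: le_diff_conv2)
  qed
qed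

lemma distance_le_sum_steps:
  fixes X g :: "nat \<Rightarrow> real"
  assumes "\<And>n. \<bar>X (Suc n) - X n\<bar> \<le> g n" "m \<le> n"
  shows "\<bar>X n - X m\<bar> \<le> (\<Sum>i\<in>{m..<n}. g i)"
proof -
  have "\<bar>X n - X m\<bar> = \<bar>\<Sum>i\<in>{m..<n}. X (Suc i) - X i\<bar>"
    using assms(2) by (simp add: sum_Suc_diff')
  also have "\<dots> \<le> (\<Sum>i\<in>{m..<n}. g i)"
    using assms(1) by (intro order_trans[OF sum_abs] sum_mono)
  finally show ?thesis .
qed

text \<open>
  The noise is expressed through the sequence and its drift alone, so that the convergence argument
  applies to a single trajectory without reference to randomness.
\<close>
definition block_noise ::
  "(real \<Rightarrow> real) \<Rightarrow> (nat \<Rightarrow> real) \<Rightarrow> real \<Rightarrow> (nat \<Rightarrow> real) \<Rightarrow> nat \<Rightarrow> real" where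
  "block_noise h g \<delta> X j =
     X (block g \<delta> (Suc j)) - X (block g \<delta> j)
       - (\<Sum>i\<in>{block g \<delta> j..<block g \<delta> (Suc j)}. g i * h (X i))"

context
  fixes X g :: "nat \<Rightarrow> real" and h :: "real \<Rightarrow> real" and S :: "real set" and z \<kappa> K L :: real
  assumes g_nonneg: "\<And>n. 0 \<le> g n" and g_lim: "g \<longlonglongrightarrow> 0"
    and g_div: "filterlim (\<lambda>n. \<Sum>i<n. g i) at_top sequentially"
    and X_in: "\<And>n. X n \<in> S"
    and X_step: "\<And>n. \<bar>X (Suc n) - X n\<bar> \<le> g n"
    and h_lip: "\<And>x y. x \<in> S \<Longrightarrow> y \<in> S \<Longrightarrow> \<bar>h x - h y\<bar> \<le> L * \<bar>x - y\<bar>"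
    and L: "0 \<le> L"
    and kappa: "0 < \<kappa>"
    and h_rev: "\<And>x. x \<in> S \<Longrightarrow> \<exists>k\<in>{\<kappa>..K}. h x = - k * (x - z)"
begin

text \<open>
  An Euler step of length \<open>T \<in> [\<delta>, 2 \<delta>]\<close> multiplies \<open>x - z\<close> by \<open>1 - T k\<close>, which lies in
  \<open>[0, 1 - \<kappa> \<delta>]\<close> by the condition on \<open>K\<close>. The block differs from such a step by the noise and by the
  error \<open>E\<close> of freezing the drift at the start of the block, at most
  \<open>T \<sqdot> L \<sqdot> 2 \<delta> \<le> 4 L \<delta>\<^sup>2\<close>.
\<close>
lemma block_contraction:
  assumes \<delta>: "0 < \<delta>" "2 * K * \<delta> \<le> 1"
    and T: "(\<Sum>i\<in>{block g \<delta> j..<block g \<delta> (Suc j)}. g i) \<le> 2 * \<delta>"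
    and noise: "\<bar>block_noise h g \<delta> X j\<bar> \<le> \<delta>\<^sup>2"
  shows "\<bar>X (block g \<delta> (Suc j)) - z\<bar>
           \<le> (1 - \<kappa> * \<delta>) * \<bar>X (block g \<delta> j) - z\<bar> + (4 * L + 1) * \<delta>\<^sup>2"
proof -
  let ?N = "block g \<delta> j" and ?N' = "block g \<delta> (Suc j)"
  define I where "I = {?N..<?N'}"
  define T where "T = (\<Sum>i\<in>I. g i)"
  have T_bds: "\<delta> \<le> T" "T \<le> 2 * \<delta>"
    using T block_sum_ge[OF g_div \<delta>(1)] by (simp_all only: T_def I_def)
  obtain k where k: "\<kappa> \<le> k" "k \<le> K" "h (X ?N) = - k * (X ?N - z)"
    using h_rev[OF X_in] by force
  define E where "E = (\<Sum>i\<in>I. g i * (h (X i) - h (X ?N)))"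
  have "\<bar>E\<bar> \<le> (\<Sum>i\<in>I. g i * (L * (2 * \<delta>)))"
    unfolding E_def
  proof (rule order_trans[OF sum_abs], rule sum_mono)
    fix i assume i: "i \<in> I"
    have "\<bar>X i - X ?N\<bar> \<le> (\<Sum>l\<in>{?N..<i}. g l)"
      using i by (intro distance_le_sum_steps X_step) (auto simp: I_def)
    also have "\<dots> \<le> T"
      using i g_nonneg unfolding T_def by (intro sum_mono2) (auto simp: I_def)
    finally have "\<bar>X i - X ?N\<bar> \<le> 2 * \<delta>" using T_bds by simp
    then have "\<bar>h (X i) - h (X ?N)\<bar> \<le> L * (2 * \<delta>)"
      using L by (intro order_trans[OF h_lip[OF X_in X_in]] mult_left_mono)
    then show "\<bar>g i * (h (X i) - h (X ?N))\<bar> \<le> g i * (L * (2 * \<delta>))"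
      using g_nonneg by (simp add: abs_mult mult_left_mono)
  qed
  also have "\<dots> = T * (L * (2 * \<delta>))" by (simp add: T_def sum_distrib_right)
  also have "\<dots> \<le> (2 * \<delta>) * (L * (2 * \<delta>))"
    using T_bds L \<delta> by (intro mult_right_mono) auto
  finally have E: "\<bar>E\<bar> \<le> 4 * L * \<delta>\<^sup>2" by (simp add: power2_eq_square algebra_simps)
  have "(\<Sum>i\<in>I. g i * h (X i)) = E + T * h (X ?N)"
    by (simp add: E_def T_def right_diff_distrib sum_subtractf sum_distrib_right)
  then have "X ?N' - z = (1 - T * k) * (X ?N - z) + E + block_noise h g \<delta> X j"
    by (simp add: block_noise_def I_def[symmetric] k(3) algebra_simps del: block.simps)
  then have "\<bar>X ?N' - z\<bar> \<le> \<bar>(1 - T * k) * (X ?N - z)\<bar> + \<bar>E\<bar> + \<bar>block_noise h g \<delta> X j\<bar>"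
    by linarith
  moreover have "\<bar>(1 - T * k) * (X ?N - z)\<bar> \<le> (1 - \<kappa> * \<delta>) * \<bar>X ?N - z\<bar>"
  proof -
    have "\<kappa> * \<delta> \<le> k * T" "k * T \<le> K * (2 * \<delta>)"
      using k T_bds \<delta> kappa by (auto intro!: mult_mono)
    then have "0 \<le> 1 - T * k" "1 - T * k \<le> 1 - \<kappa> * \<delta>"
      using \<delta>(2) by (auto simp: algebra_simps)
    then show ?thesis by (simp add: abs_mult mult_right_mono)
  qed
  ultimately show ?thesis using E noise by (simp add: algebra_simps)
qed

text \<open>
  The contraction over blocks has \<open>B = (4 L + 1) \<delta> / \<kappa>\<close> as fixed point of its bound. Of the further
  \<open>2 \<delta>\<close>, one \<open>\<delta>\<close> covers the approach to \<open>B\<close> and the other the movement inside a block.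
\<close>
lemma eventually_close_of_small_noise:
  assumes \<delta>: "0 < \<delta>" "2 * K * \<delta> \<le> 1"
    and noise: "\<forall>\<^sub>F j in sequentially. \<bar>block_noise h g \<delta> X j\<bar> \<le> \<delta>\<^sup>2"
  shows "\<forall>\<^sub>F n in sequentially. \<bar>X n - z\<bar> \<le> ((4 * L + 1) / \<kappa> + 2) * \<delta>"
proof -
  define N where "N = block g \<delta>"
  have N_mono: "strict_mono N"
    unfolding N_def by (rule block_strict_mono[OF g_div \<delta>(1)])
  have "\<forall>\<^sub>F n in sequentially. g n < \<delta>"
    using g_lim \<delta>(1) by (rule order_tendstoD)
  with noise have "\<forall>\<^sub>F n in sequentially. \<bar>block_noise h g \<delta> X n\<bar> \<le> \<delta>\<^sup>2 \<and> g n < \<delta>"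
    by (rule eventually_conj)
  then obtain J where J: "\<And>j. j \<ge> J \<Longrightarrow> \<bar>block_noise h g \<delta> X j\<bar> \<le> \<delta>\<^sup>2" "\<And>n. n \<ge> J \<Longrightarrow> g n \<le> \<delta>"
    unfolding eventually_sequentially by (meson less_imp_le)
  have T: "(\<Sum>i\<in>{N j..<N (Suc j)}. g i) \<le> 2 * \<delta>" if "j \<ge> J" for j
    using block_sum_le[OF g_div \<delta>(1), of j \<delta>] that J(2) strict_mono_imp_increasing[OF N_mono, of j]
    unfolding N_def by fastforce
  have "\<kappa> \<le> K" using h_rev[OF X_in[of 0]] by force
  then have "\<kappa> * \<delta> \<le> K * \<delta>" "0 \<le> K * \<delta>" using \<delta>(1) kappa by (auto intro: mult_right_mono)
  then have \<kappa>\<delta>: "\<kappa> * \<delta> \<le> 1" using \<delta>(2) by linarith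
  define B where "B = (4 * L + 1) / \<kappa> * \<delta>"
  have B: "\<kappa> * \<delta> * B = (4 * L + 1) * \<delta>\<^sup>2"
    using kappa by (simp add: B_def field_simps power2_eq_square)
  have "\<bar>X (N (Suc j)) - z\<bar> \<le> (1 - \<kappa> * \<delta>) * \<bar>X (N j) - z\<bar> + \<kappa> * \<delta> * B" if "j \<ge> J" for j
    using block_contraction[OF \<delta> T[OF that, unfolded N_def] J(1)[OF that]] by (simp only: N_def B)
  then have "\<forall>\<^sub>F j in sequentially. \<bar>X (N j) - z\<bar> \<le> B + \<delta>"
    using \<kappa>\<delta> \<delta>(1) kappa by (intro contraction_eventually_le[where q="\<kappa> * \<delta>" and J=J]) auto
  then obtain J' where J': "\<And>j. j \<ge> J' \<Longrightarrow> \<bar>X (N j) - z\<bar> \<le> B + \<delta>"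
    by (auto simp: eventually_sequentially)
  define J0 where "J0 = max J J'"
  show ?thesis
    unfolding eventually_sequentially
  proof (intro exI allI impI)
    fix n assume n: "N J0 \<le> n"
    have n_less: "n < N (Suc n)"
      using strict_mono_imp_increasing[OF N_mono, of "Suc n"] by simp
    define j where "j = (LEAST j. n < N (Suc j))"
    have j: "n < N (Suc j)" unfolding j_def by (rule LeastI[of "\<lambda>j. n < N (Suc j)"]) fact
    have "J0 \<le> j"
      using n j strict_mono_less[OF N_mono, of J0 "Suc j"] by simp
    have "N j \<le> n"
    proof (cases "j = J0")
      case False
      then obtain i where i: "j = Suc i" using \<open>J0 \<le> j\<close> by (cases j) auto
      then show ?thesis using not_less_Least[of i "\<lambda>j. n < N (Suc j)"] by (simp add: j_def)
    qed (use n in simp)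
    have "\<bar>X n - X (N j)\<bar> \<le> (\<Sum>i\<in>{N j..<n}. g i)"
      by (rule distance_le_sum_steps[of X g, OF X_step \<open>N j \<le> n\<close>])
    also have "\<dots> \<le> \<delta>"
      using block_sum_less[OF g_div \<delta>(1), of n j] j unfolding N_def by simp
    finally have "\<bar>X n - X (N j)\<bar> \<le> \<delta>" .
    moreover have "\<bar>X (N j) - z\<bar> \<le> B + \<delta>" using J' \<open>J0 \<le> j\<close> by (simp add: J0_def)
    ultimately have "\<bar>X n - z\<bar> \<le> B + 2 * \<delta>" using \<delta>(1) by linarith
    then show "\<bar>X n - z\<bar> \<le> ((4 * L + 1) / \<kappa> + 2) * \<delta>"
      by (simp add: B_def algebra_simps)
  qed
qed

theorem mean_reverting_recursion_tendsto:
  assumes noise: "\<And>m. \<forall>\<^sub>F j in sequentially.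
      \<bar>block_noise h g (inverse (Suc m)) X j\<bar> \<le> (inverse (Suc m))\<^sup>2"
  shows "X \<longlonglongrightarrow> z"
proof (rule LIMSEQ_I)
  fix e :: real assume "0 < e"
  define C where "C = (4 * L + 1) / \<kappa> + 2"
  have C: "C > 0" using L kappa by (simp add: C_def add_nonneg_pos)
  have "(\<lambda>m. inverse (real (Suc m))) \<longlonglongrightarrow> 0" by (rule LIMSEQ_inverse_real_of_nat)
  then have "(\<lambda>m. 2 * K * inverse (real (Suc m))) \<longlonglongrightarrow> 2 * K * 0"
    "(\<lambda>m. C * inverse (real (Suc m))) \<longlonglongrightarrow> C * 0"
    by (intro tendsto_mult tendsto_const; assumption)+
  then have "\<forall>\<^sub>F m in sequentially. 2 * K * inverse (real (Suc m)) < 1"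
    "\<forall>\<^sub>F m in sequentially. C * inverse (real (Suc m)) < e"
    using \<open>0 < e\<close> by (auto intro: order_tendstoD(2))
  then have "\<forall>\<^sub>F m in sequentially. 2 * K * inverse (real (Suc m)) < 1 \<and> C * inverse (real (Suc m)) < e"
    by (rule eventually_conj)
  then obtain m where m: "2 * K * inverse (real (Suc m)) \<le> 1" "C * inverse (real (Suc m)) < e"
    unfolding eventually_sequentially by (meson less_imp_le order_refl)
  have "\<forall>\<^sub>F n in sequentially. \<bar>X n - z\<bar> \<le> C * inverse (real (Suc m))"
    unfolding C_def
    by (rule eventually_close_of_small_noise[OF _ m(1) noise]) simp
  then show "\<exists>n0. \<forall>n\<ge>n0. norm (X n - z) < e"
    using m(2) by (force simp: eventually_sequentially)
qed

end

section \<open>Exponential bounds for recursions driven by independent inputs\<close>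

text \<open>
  A substitute for conditional expectations: if \<open>W\<close> is independent of \<open>V\<close>, a bound on the mean over
  \<open>W\<close> for each frozen value of \<open>V\<close> may be integrated over \<open>V\<close>, by Fubini on the joint distribution.
\<close>
lemma (in prob_space) nn_integral_indep_var_le:
  fixes V W :: "'a \<Rightarrow> 'b"
  assumes ind: "indep_var S V T W"
    and \<Phi> [measurable]: "case_prod \<Phi> \<in> borel_measurable (S \<Otimes>\<^sub>M T)"
    and \<psi> [measurable]: "\<psi> \<in> borel_measurable S"
    and le: "\<And>v. v \<in> space S \<Longrightarrow> (\<integral>\<^sup>+\<omega>. \<Phi> v (W \<omega>) \<partial>M) \<le> c * \<psi> v"
  shows "(\<integral>\<^sup>+\<omega>. \<Phi> (V \<omega>) (W \<omega>) \<partial>M) \<le> c * (\<integral>\<^sup>+\<omega>. \<psi> (V \<omega>) \<partial>M)"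
proof -
  have V [measurable]: "V \<in> measurable M S" and W [measurable]: "W \<in> measurable M T"
    and eq: "distr M S V \<Otimes>\<^sub>M distr M T W = distr M (S \<Otimes>\<^sub>M T) (\<lambda>\<omega>. (V \<omega>, W \<omega>))"
    using ind by (auto simp: indep_var_distribution_eq)
  interpret W: prob_space "distr M T W" by (rule prob_space_distr) fact
  have "(\<integral>\<^sup>+\<omega>. \<Phi> (V \<omega>) (W \<omega>) \<partial>M) = (\<integral>\<^sup>+p. case_prod \<Phi> p \<partial>distr M (S \<Otimes>\<^sub>M T) (\<lambda>\<omega>. (V \<omega>, W \<omega>)))"
    by (subst nn_integral_distr) auto
  also have "\<dots> = (\<integral>\<^sup>+v. \<integral>\<^sup>+w. \<Phi> v w \<partial>distr M T W \<partial>distr M S V)"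
    by (subst eq[symmetric], subst W.nn_integral_fst[symmetric]) auto
  also have "\<dots> = (\<integral>\<^sup>+v. \<integral>\<^sup>+\<omega>. \<Phi> v (W \<omega>) \<partial>M \<partial>distr M S V)"
    by (intro nn_integral_cong nn_integral_distr) (auto simp: space_distr)
  also have "\<dots> \<le> (\<integral>\<^sup>+v. c * \<psi> v \<partial>distr M S V)"
    using le by (intro nn_integral_mono) auto
  also have "\<dots> = c * (\<integral>\<^sup>+\<omega>. \<psi> (V \<omega>) \<partial>M)"
    by (subst nn_integral_cmult) (auto simp: nn_integral_distr)
  finally show ?thesis .
qed

text \<open>
  Hoeffding's lemma with \<open>l\<close> of either sign, so that both tails come out of one moment bound.
\<close>
lemma (in prob_space) hoeffding_lemma_unit:
  fixes f :: "'a \<Rightarrow> real"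
  assumes f [measurable]: "f \<in> borel_measurable M" and bd: "\<And>\<omega>. \<bar>f \<omega>\<bar> \<le> 1"
  shows "(\<integral>\<^sup>+\<omega>. ennreal (exp (l * (f \<omega> - expectation f))) \<partial>M) \<le> ennreal (exp (l\<^sup>2 / 2))"
proof -
  have pos: "(\<integral>\<^sup>+\<omega>. ennreal (exp (l * (f \<omega> - expectation f))) \<partial>M) \<le> ennreal (exp (l\<^sup>2 / 2))"
    if "l > 0" "f \<in> borel_measurable M" "\<And>\<omega>. \<bar>f \<omega>\<bar> \<le> 1" for l and f :: "'a \<Rightarrow> real"
  proof -
    interpret f: interval_bounded_random_variable M f "-1" 1
      using that by unfold_locales (auto simp: abs_le_iff minus_le_iff)
    show ?thesis
      using f.Hoeffdings_lemma_nn_integral[OF that(1)] by simp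
  qed
  consider "l > 0" | "l = 0" | "l < 0" by linarith
  then show ?thesis
  proof cases
    case 3
    have "(\<integral>\<^sup>+\<omega>. ennreal (exp ((- l) * (- f \<omega> - expectation (\<lambda>\<omega>. - f \<omega>)))) \<partial>M)
            \<le> ennreal (exp ((- l)\<^sup>2 / 2))"
      using 3 bd by (intro pos) auto
    then show ?thesis by (simp add: algebra_simps)
  qed (use pos[OF _ f bd] in \<open>auto simp: emeasure_space_1\<close>)
qed

text \<open>
  Only independence of finite initial segments of the inputs is assumed, since each step of the
  analysis looks at finitely many of them.
\<close>
locale driven_recursion = prob_space M for M :: "'a measure" +
  fixes N :: "'b measure" and Z :: "nat \<Rightarrow> 'a \<Rightarrow> 'b"
    and F :: "real \<Rightarrow> 'b \<Rightarrow> real" and h :: "real \<Rightarrow> real" and g :: "nat \<Rightarrow> real" and x0 :: real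
  assumes indep: "\<And>n. indep_vars (\<lambda>_. N) Z {..n}"
    and F_measurable [measurable]: "case_prod F \<in> borel_measurable (borel \<Otimes>\<^sub>M N)"
    and h_measurable [measurable]: "h \<in> borel_measurable borel"
    and x0: "x0 \<in> {0..1}"
    and F_bound: "\<And>x z. x \<in> {0..1} \<Longrightarrow> \<bar>F x z\<bar> \<le> 1"
    and F_mean: "\<And>x n. x \<in> {0..1} \<Longrightarrow> expectation (\<lambda>\<omega>. F x (Z n \<omega>)) = h x"
    and F_invariant: "\<And>x z n. x \<in> {0..1} \<Longrightarrow> x + g n * F x z \<in> {0..1}"
begin

text \<open>
  The recursion is run on a deterministic input sequence \<open>z\<close>. Seen this way, the state before step
  \<open>n\<close> is a measurable function of the inputs \<open>z i\<close> with \<open>i < n\<close>, hence independent of the \<open>n\<close>-th input.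
\<close>
primrec trajectory :: "(nat \<Rightarrow> 'b) \<Rightarrow> nat \<Rightarrow> real" where
  "trajectory z 0 = x0"
| "trajectory z (Suc n) = trajectory z n + g n * F (trajectory z n) (z n)"

definition noise :: "nat \<Rightarrow> nat \<Rightarrow> (nat \<Rightarrow> 'b) \<Rightarrow> real" where
  "noise m n z = (\<Sum>i\<in>{m..<n}. g i * (F (trajectory z i) (z i) - h (trajectory z i)))"

lemma Z_measurable [measurable]: "Z n \<in> measurable M N"
  using indep[of n] by (auto simp: indep_vars_def)

lemma trajectory_in_unit: "trajectory z n \<in> {0..1}"
  by (induction n) (use x0 F_invariant in auto)

lemma trajectory_cong: "(\<And>i. i < n \<Longrightarrow> z i = z' i) \<Longrightarrow> trajectory z n = trajectory z' n"
  by (induction n) auto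

lemma noise_cong:
  assumes "\<And>i. i < n \<Longrightarrow> z i = z' i"
  shows "noise m n z = noise m n z'"
proof -
  have "trajectory z i = trajectory z' i" if "i < n" for i
    using assms that by (intro trajectory_cong) auto
  then show ?thesis unfolding noise_def using assms by (intro sum.cong) auto
qed

lemma trajectory_measurable: "{..<n} \<subseteq> I \<Longrightarrow> (\<lambda>z. trajectory z n) \<in> borel_measurable (PiM I (\<lambda>_. N))"
proof (induction n)
  case (Suc n)
  from Suc.prems have "{..<n} \<subseteq> I" "n \<in> I" by auto
  with Suc.IH have [measurable]: "(\<lambda>z. trajectory z n) \<in> borel_measurable (PiM I (\<lambda>_. N))"
    "(\<lambda>z. z n) \<in> measurable (PiM I (\<lambda>_. N)) N"
    by (auto intro: measurable_component_singleton)
  show ?case by simp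
qed simp

lemma noise_measurable:
  assumes "{..<n} \<subseteq> I"
  shows "(\<lambda>z. noise m n z) \<in> borel_measurable (PiM I (\<lambda>_. N))"
  unfolding noise_def
proof (intro borel_measurable_sum)
  fix i assume "i \<in> {m..<n}"
  with assms have [measurable]: "(\<lambda>z. trajectory z i) \<in> borel_measurable (PiM I (\<lambda>_. N))"
    "(\<lambda>z. z i) \<in> measurable (PiM I (\<lambda>_. N)) N"
    by (auto intro!: measurable_component_singleton trajectory_measurable)
  show "(\<lambda>z. g i * (F (trajectory z i) (z i) - h (trajectory z i))) \<in> borel_measurable (PiM I (\<lambda>_. N))"
    by simp
qed

lemma noise_measurable' [measurable]: "(\<lambda>\<omega>. noise m n (\<lambda>i. Z i \<omega>)) \<in> borel_measurable M"
proof -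
  have "(\<lambda>\<omega>. noise m n (\<lambda>i\<in>UNIV. Z i \<omega>)) \<in> borel_measurable M"
    by (rule measurable_compose[OF _ noise_measurable[of n UNIV]])
       (auto intro!: measurable_restrict)
  then show ?thesis by (simp add: restrict_def)
qed

text \<open>
  The Azuma-Hoeffding moment bound. Conditionally on the inputs before \<open>n\<close> the new summand is centred
  and lies in an interval of length \<open>2 \<bar>g n\<bar>\<close>, so it multiplies the exponential moment by at most
  \<open>exp ((l g n)\<^sup>2 / 2)\<close>.
\<close>
lemma noise_exp_moment:
  assumes "m \<le> n"
  shows "(\<integral>\<^sup>+\<omega>. ennreal (exp (l * noise m n (\<lambda>i. Z i \<omega>))) \<partial>M)
           \<le> ennreal (exp (l\<^sup>2 / 2 * (\<Sum>i\<in>{m..<n}. (g i)\<^sup>2)))"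
  using assms
proof (induction n rule: dec_induct)
  case base
  then show ?case by (simp add: noise_def emeasure_space_1)
next
  case (step n)
  define V where "V = (\<lambda>\<omega>. \<lambda>i\<in>{..<n}. Z i \<omega>)"
  define W where "W = (\<lambda>\<omega>. \<lambda>i\<in>{n}. Z i \<omega>)"
  define \<psi> where "\<psi> v = ennreal (exp (l * noise m n v))" for v
  define \<Phi> where "\<Phi> v w = \<psi> v * ennreal (exp ((l * g n) * (F (trajectory v n) (w n) - h (trajectory v n))))"
    for v and w :: "nat \<Rightarrow> 'b"
  note [measurable] = trajectory_measurable[of n "{..<n}", OF order_refl]
    noise_measurable[of n "{..<n}", OF order_refl]
  have [measurable]: "(\<lambda>w. w n) \<in> measurable (PiM {n} (\<lambda>_. N)) N"
    by (rule measurable_component_singleton) simp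
  have V_W: "indep_var (PiM {..<n} (\<lambda>_. N)) V (PiM {n} (\<lambda>_. N)) W"
    unfolding V_def W_def by (rule indep_var_restrict[OF indep[of n]]) auto
  have \<Phi>_measurable: "case_prod \<Phi> \<in> borel_measurable (PiM {..<n} (\<lambda>_. N) \<Otimes>\<^sub>M PiM {n} (\<lambda>_. N))"
    unfolding \<Phi>_def \<psi>_def by measurable
  have \<psi>_measurable: "\<psi> \<in> borel_measurable (PiM {..<n} (\<lambda>_. N))"
    unfolding \<psi>_def by measurable
  have increment: "(\<integral>\<^sup>+\<omega>. \<Phi> v (W \<omega>) \<partial>M) \<le> ennreal (exp ((l * g n)\<^sup>2 / 2)) * \<psi> v"
    if "v \<in> space (PiM {..<n} (\<lambda>_. N))" for v
  proof -
    let ?x = "trajectory v n"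
    have "(\<integral>\<^sup>+\<omega>. \<Phi> v (W \<omega>) \<partial>M)
        = \<psi> v * (\<integral>\<^sup>+\<omega>. ennreal (exp ((l * g n) * (F ?x (Z n \<omega>) - h ?x))) \<partial>M)"
      by (simp add: \<Phi>_def W_def nn_integral_cmult)
    also have "\<dots> \<le> \<psi> v * ennreal (exp ((l * g n)\<^sup>2 / 2))"
      using hoeffding_lemma_unit[of "\<lambda>\<omega>. F ?x (Z n \<omega>)" "l * g n"] trajectory_in_unit[of v n]
      by (intro mult_left_mono) (auto simp: F_mean F_bound)
    finally show ?thesis by (simp add: mult.commute)
  qed
  have "(\<integral>\<^sup>+\<omega>. \<Phi> (V \<omega>) (W \<omega>) \<partial>M)
      \<le> ennreal (exp ((l * g n)\<^sup>2 / 2)) * (\<integral>\<^sup>+\<omega>. \<psi> (V \<omega>) \<partial>M)"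
    using increment by (rule nn_integral_indep_var_le[OF V_W \<Phi>_measurable \<psi>_measurable])
  also have "(\<integral>\<^sup>+\<omega>. \<psi> (V \<omega>) \<partial>M) = (\<integral>\<^sup>+\<omega>. ennreal (exp (l * noise m n (\<lambda>i. Z i \<omega>))) \<partial>M)"
    unfolding \<psi>_def V_def
    by (intro nn_integral_cong arg_cong[where f="\<lambda>t. ennreal (exp (l * t))"] noise_cong) simp
  also have "ennreal (exp ((l * g n)\<^sup>2 / 2)) * \<dots>
      \<le> ennreal (exp ((l * g n)\<^sup>2 / 2)) * ennreal (exp (l\<^sup>2 / 2 * (\<Sum>i\<in>{m..<n}. (g i)\<^sup>2)))"
    by (intro mult_left_mono step.IH) simp
  also have "\<dots> = ennreal (exp (l\<^sup>2 / 2 * (\<Sum>i\<in>{m..<Suc n}. (g i)\<^sup>2)))"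
    using step.hyps
    by (simp add: ennreal_mult[symmetric] exp_add[symmetric] algebra_simps power_mult_distrib)
  also have "(\<integral>\<^sup>+\<omega>. \<Phi> (V \<omega>) (W \<omega>) \<partial>M)
      = (\<integral>\<^sup>+\<omega>. ennreal (exp (l * noise m (Suc n) (\<lambda>i. Z i \<omega>))) \<partial>M)"
  proof (intro nn_integral_cong)
    fix \<omega>
    have "trajectory (V \<omega>) n = trajectory (\<lambda>i. Z i \<omega>) n" "noise m n (V \<omega>) = noise m n (\<lambda>i. Z i \<omega>)"
      by (auto simp: V_def intro: trajectory_cong noise_cong)
    moreover have "noise m (Suc n) (\<lambda>i. Z i \<omega>) = noise m n (\<lambda>i. Z i \<omega>)
        + g n * (F (trajectory (\<lambda>i. Z i \<omega>) n) (Z n \<omega>) - h (trajectory (\<lambda>i. Z i \<omega>) n))"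
      using step.hyps by (simp add: noise_def)
    ultimately show "\<Phi> (V \<omega>) (W \<omega>) = ennreal (exp (l * noise m (Suc n) (\<lambda>i. Z i \<omega>)))"
      by (simp add: \<Phi>_def \<psi>_def W_def ennreal_mult[symmetric] exp_add[symmetric] distrib_left mult.assoc)
  qed
  finally show ?case .
qed

lemma noise_tail:
  assumes "m \<le> n" "0 < s" "(\<Sum>i\<in>{m..<n}. (g i)\<^sup>2) \<le> s" "0 < \<eta>"
  shows "prob {\<omega> \<in> space M. \<bar>noise m n (\<lambda>i. Z i \<omega>)\<bar> \<ge> \<eta>} \<le> 2 * exp (- \<eta>\<^sup>2 / (2 * s))"
proof -
  let ?S = "\<lambda>\<omega>. noise m n (\<lambda>i. Z i \<omega>)"
  \<comment> \<open>the signs \<open>c = 1\<close> and \<open>c = - 1\<close> give the two tails\<close>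
  have tail: "prob {\<omega> \<in> space M. c * ?S \<omega> \<ge> \<eta>} \<le> exp (- \<eta>\<^sup>2 / (2 * s))" if c: "c\<^sup>2 = 1" for c
  proof -
    \<comment> \<open>the minimiser of the Chernoff exponent \<open>l\<^sup>2 s / 2 - l \<eta>\<close>\<close>
    define l where "l = \<eta> / s"
    have "emeasure M {\<omega> \<in> space M. c * ?S \<omega> \<ge> \<eta>}
        \<le> ennreal (exp (- l * \<eta>)) * (\<integral>\<^sup>+\<omega>. ennreal (exp (l * (c * ?S \<omega>))) * indicator (space M) \<omega> \<partial>M)"
      using assms by (intro Chernoff_ineq_nn_integral_ge) (auto simp: l_def)
    also have "(\<integral>\<^sup>+\<omega>. ennreal (exp (l * (c * ?S \<omega>))) * indicator (space M) \<omega> \<partial>M)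
        = (\<integral>\<^sup>+\<omega>. ennreal (exp ((l * c) * ?S \<omega>)) \<partial>M)"
      by (intro nn_integral_cong) (simp add: mult.assoc)
    also have "\<dots> \<le> ennreal (exp ((l * c)\<^sup>2 / 2 * (\<Sum>i\<in>{m..<n}. (g i)\<^sup>2)))"
      by (rule noise_exp_moment) fact
    also have "\<dots> \<le> ennreal (exp (l\<^sup>2 / 2 * s))"
      using assms(3) by (intro ennreal_leI) (simp add: power_mult_distrib c mult_left_mono)
    also have "ennreal (exp (- l * \<eta>)) * \<dots> = ennreal (exp (- \<eta>\<^sup>2 / (2 * s)))"
      using assms(2) by (simp add: ennreal_mult[symmetric] exp_add[symmetric] l_def field_simps power2_eq_square)
    finally show ?thesis
      by (simp add: emeasure_eq_measure mult_left_mono)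
  qed
  have "prob {\<omega> \<in> space M. \<bar>?S \<omega>\<bar> \<ge> \<eta>}
      \<le> prob ({\<omega> \<in> space M. 1 * ?S \<omega> \<ge> \<eta>} \<union> {\<omega> \<in> space M. (-1) * ?S \<omega> \<ge> \<eta>})"
    by (intro finite_measure_mono) auto
  also have "\<dots> \<le> prob {\<omega> \<in> space M. 1 * ?S \<omega> \<ge> \<eta>} + prob {\<omega> \<in> space M. (-1) * ?S \<omega> \<ge> \<eta>}"
    by (intro measure_Un_le) auto
  also have "\<dots> \<le> exp (- \<eta>\<^sup>2 / (2 * s)) + exp (- \<eta>\<^sup>2 / (2 * s))"
    by (intro add_mono tail) auto
  finally show ?thesis by simp
qed

lemma block_noise_trajectory:
  assumes "block g \<delta> j \<le> block g \<delta> (Suc j)"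
  shows "block_noise h g \<delta> (trajectory z) j = noise (block g \<delta> j) (block g \<delta> (Suc j)) z"
proof -
  let ?N = "block g \<delta> j" and ?N' = "block g \<delta> (Suc j)"
  have "trajectory z ?N' - trajectory z ?N = (\<Sum>i\<in>{?N..<?N'}. trajectory z (Suc i) - trajectory z i)"
    using assms by (simp only: sum_Suc_diff')
  then show ?thesis
    by (simp add: block_noise_def noise_def sum_subtractf right_diff_distrib del: block.simps)
qed

text \<open>
  Since \<open>g\<close> is non-increasing, the variance proxy of a block is at most its first step times its duration,
  which is at most \<open>\<delta> + 1\<close>. The tail bounds are then terms of the convergent series \<open>g_exp\<close>, taken at
  the distinct indices \<open>block g \<delta> j\<close>, and Borel-Cantelli applies.
\<close>
lemma AE_block_noise_small:
  assumes g_pos: "\<And>n. 0 < g n" and g_le: "\<And>n. g n \<le> 1" and g_dec: "antimono g"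
    and g_div: "filterlim (\<lambda>n. \<Sum>i<n. g i) at_top sequentially"
    and g_exp: "\<And>\<theta>. \<theta> > 0 \<Longrightarrow> summable (\<lambda>n. exp (- \<theta> / g n))"
    and "0 < \<delta>" "0 < \<eta>"
  shows "AE \<omega> in M. \<forall>\<^sub>F j in sequentially. \<bar>block_noise h g \<delta> (trajectory (\<lambda>i. Z i \<omega>)) j\<bar> \<le> \<eta>"
proof -
  let ?b = "block g \<delta>"
  define Bad where "Bad j = {\<omega> \<in> space M. \<bar>noise (?b j) (?b (Suc j)) (\<lambda>i. Z i \<omega>)\<bar> \<ge> \<eta>}" for j
  define \<theta> where "\<theta> = \<eta>\<^sup>2 / (2 * (\<delta> + 1))"
  have \<theta>: "\<theta> > 0" using assms(6,7) by (simp add: \<theta>_def)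
  have b_less: "?b j < ?b (Suc j)" for j by (rule block_less[OF g_div \<open>0 < \<delta>\<close>])
  have Bad_le: "prob (Bad j) \<le> 2 * exp (- \<theta> / g (?b j))" for j
  proof -
    have "(\<Sum>i\<in>{?b j..<?b (Suc j)}. (g i)\<^sup>2) \<le> (\<Sum>i\<in>{?b j..<?b (Suc j)}. g (?b j) * g i)"
      using g_pos g_dec unfolding power2_eq_square
      by (intro sum_mono mult_right_mono) (auto simp: antimono_def less_imp_le)
    also have "\<dots> \<le> g (?b j) * (\<delta> + 1)"
      unfolding sum_distrib_left[symmetric]
      using g_pos g_le by (intro mult_left_mono block_sum_le[OF g_div \<open>0 < \<delta>\<close>]) (auto simp: less_imp_le)
    finally have "prob (Bad j) \<le> 2 * exp (- \<eta>\<^sup>2 / (2 * (g (?b j) * (\<delta> + 1))))"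
      unfolding Bad_def using b_less[of j] g_pos assms(6,7) by (intro noise_tail) auto
    also have "- \<eta>\<^sup>2 / (2 * (g (?b j) * (\<delta> + 1))) = - \<theta> / g (?b j)"
      by (simp add: \<theta>_def field_simps)
    finally show ?thesis .
  qed
  have "summable ((\<lambda>n. exp (- \<theta> / g n)) \<circ> ?b)"
    using strict_mono_imp_inj_on[OF block_strict_mono[OF g_div \<open>0 < \<delta>\<close>]]
    by (intro summable_reindex g_exp \<theta>) auto
  then have "summable (\<lambda>j. 2 * exp (- \<theta> / g (?b j)))"
    by (intro summable_mult) (simp add: comp_def)
  then have "summable (\<lambda>j. prob (Bad j))"
    by (rule summable_comparison_test') (use Bad_le in auto)
  then have "AE \<omega> in M. \<forall>\<^sub>F j in sequentially. \<omega> \<in> space M - Bad j"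
    by (intro borel_cantelli_AE1) (auto simp: Bad_def emeasure_eq_measure simp del: block.simps)
  then show ?thesis
  proof eventually_elim
    case (elim \<omega>)
    then show ?case
    proof eventually_elim
      case (elim j)
      then show ?case
        using block_noise_trajectory[OF less_imp_le[OF b_less[of j]]] by (auto simp: Bad_def simp del: block.simps)
    qed
  qed
qed

end

section \<open>Independence of the joint inputs\<close>

lemma (in prob_space) indep_rvs_prob:
  assumes "indep_rvs M S X T Y" "C \<in> sets S" "D \<in> sets T"
  shows "prob ((X -` C \<inter> space M) \<inter> (Y -` D \<inter> space M))
           = prob (X -` C \<inter> space M) * prob (Y -` D \<inter> space M)"
proof (rule indep_setD)
  show "indep_set (sets (vimage_algebra (space M) X S)) (sets (vimage_algebra (space M) Y T))"
    using assms(1) by (simp add: indep_rvs_def)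
qed (use assms in_vimage_algebra in auto)

text \<open>
  Independence of the two families from each other and within each family makes the pairs
  independent: on rectangles all probabilities factor, and rectangles generate the product algebra
  and are closed under intersection.
\<close>
lemma (in prob_space) indep_vars_Pair:
  fixes X :: "'i \<Rightarrow> 'a \<Rightarrow> 'b" and Y :: "'i \<Rightarrow> 'a \<Rightarrow> 'c"
  assumes X: "indep_vars (\<lambda>_. S) X I" and Y: "indep_vars (\<lambda>_. T) Y I"
    and XY: "indep_rvs M (PiM I (\<lambda>_. T)) (\<lambda>\<omega>. \<lambda>i\<in>I. Y i \<omega>) (PiM I (\<lambda>_. S)) (\<lambda>\<omega>. \<lambda>i\<in>I. X i \<omega>)"
    and J: "finite J" "J \<noteq> {}" "J \<subseteq> I"
  shows "indep_vars (\<lambda>_. S \<Otimes>\<^sub>M T) (\<lambda>i \<omega>. (X i \<omega>, Y i \<omega>)) J"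
proof -
  let ?E = "{a \<times> b | a b. a \<in> sets S \<and> b \<in> sets T}"
  have Xm: "X i \<in> measurable M S" and Ym: "Y i \<in> measurable M T" if "i \<in> I" for i
    using X Y that by (auto simp: indep_vars_def)
  have rect: "prob ((\<Inter>j\<in>K. X j -` a j \<inter> space M) \<inter> (\<Inter>j\<in>K. Y j -` b j \<inter> space M))
      = (\<Prod>j\<in>K. prob (X j -` a j \<inter> space M)) * (\<Prod>j\<in>K. prob (Y j -` b j \<inter> space M))"
    if K: "finite K" "K \<noteq> {}" "K \<subseteq> I" and ab: "\<And>j. j \<in> K \<Longrightarrow> a j \<in> sets S" "\<And>j. j \<in> K \<Longrightarrow> b j \<in> sets T"
    for K a b
  proof -
    let ?C = "prod_emb I (\<lambda>_. T) K (Pi\<^sub>E K b)" and ?D = "prod_emb I (\<lambda>_. S) K (Pi\<^sub>E K a)"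
    have C: "(\<lambda>\<omega>. \<lambda>i\<in>I. Y i \<omega>) -` ?C \<inter> space M = (\<Inter>j\<in>K. Y j -` b j \<inter> space M)"
      using K Ym[THEN measurable_space] by (auto simp: prod_emb_def PiE_iff subset_iff)
    have D: "(\<lambda>\<omega>. \<lambda>i\<in>I. X i \<omega>) -` ?D \<inter> space M = (\<Inter>j\<in>K. X j -` a j \<inter> space M)"
      using K Xm[THEN measurable_space] by (auto simp: prod_emb_def PiE_iff subset_iff)
    have "?C \<in> sets (PiM I (\<lambda>_. T))" "?D \<in> sets (PiM I (\<lambda>_. S))"
      using K ab by (auto intro!: sets_PiM_I)
    from indep_rvs_prob[OF XY this]
    have "prob ((\<Inter>j\<in>K. X j -` a j \<inter> space M) \<inter> (\<Inter>j\<in>K. Y j -` b j \<inter> space M))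
        = prob (\<Inter>j\<in>K. X j -` a j \<inter> space M) * prob (\<Inter>j\<in>K. Y j -` b j \<inter> space M)"
      unfolding C D by (simp only: Int_commute mult.commute)
    then show ?thesis
      using indep_varsD[OF X K(2,1,3)] indep_varsD[OF Y K(2,1,3)] ab by simp
  qed
  have Pair_vimage: "(\<lambda>\<omega>. (X i \<omega>, Y i \<omega>)) -` (a \<times> b) \<inter> space M
      = (X i -` a \<inter> space M) \<inter> (Y i -` b \<inter> space M)" for i a b
    by auto
  show ?thesis
  proof (subst indep_vars_finite[where E="\<lambda>_. ?E"])
    show "Int_stable ?E"
      by (rule Int_stable_pair_measure_generator)
    show "sets (S \<Otimes>\<^sub>M T) = sigma_sets (space (S \<Otimes>\<^sub>M T)) ?E"
      by (simp add: sets_pair_measure space_pair_measure)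
    show "space (S \<Otimes>\<^sub>M T) \<in> ?E" by (auto simp: space_pair_measure)
    show "?E \<subseteq> Pow (space (S \<Otimes>\<^sub>M T))"
      by (auto simp: space_pair_measure dest: sets.sets_into_space)
    show "random_variable (S \<Otimes>\<^sub>M T) (\<lambda>\<omega>. (X i \<omega>, Y i \<omega>))" if "i \<in> J" for i
      using that J(3) Xm Ym by auto
    show "\<forall>A\<in>J \<rightarrow> ?E. prob (\<Inter>j\<in>J. (\<lambda>\<omega>. (X j \<omega>, Y j \<omega>)) -` A j \<inter> space M)
        = (\<Prod>j\<in>J. prob ((\<lambda>\<omega>. (X j \<omega>, Y j \<omega>)) -` A j \<inter> space M))"
    proof
      fix A assume "A \<in> J \<rightarrow> ?E"
      then have "\<forall>j\<in>J. \<exists>a b. A j = a \<times> b \<and> a \<in> sets S \<and> b \<in> sets T" by auto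
      then obtain a b where ab: "\<And>j. j \<in> J \<Longrightarrow> A j = a j \<times> b j \<and> a j \<in> sets S \<and> b j \<in> sets T"
        by metis
      have "prob (\<Inter>j\<in>J. (\<lambda>\<omega>. (X j \<omega>, Y j \<omega>)) -` A j \<inter> space M)
          = prob ((\<Inter>j\<in>J. X j -` a j \<inter> space M) \<inter> (\<Inter>j\<in>J. Y j -` b j \<inter> space M))"
        using ab by (intro arg_cong[where f=prob]) (auto simp: Pair_vimage)
      also have "\<dots> = (\<Prod>j\<in>J. prob (X j -` a j \<inter> space M) * prob (Y j -` b j \<inter> space M))"
        using rect[OF J, of a b] ab by (simp add: prod.distrib)
      also have "\<dots> = (\<Prod>j\<in>J. prob ((\<lambda>\<omega>. (X j \<omega>, Y j \<omega>)) -` A j \<inter> space M))"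
      proof (rule prod.cong[OF refl])
        fix j assume j: "j \<in> J"
        then show "prob (X j -` a j \<inter> space M) * prob (Y j -` b j \<inter> space M)
            = prob ((\<lambda>\<omega>. (X j \<omega>, Y j \<omega>)) -` A j \<inter> space M)"
          using rect[of "{j}" a b] J(3) ab by (auto simp: Pair_vimage)
      qed
      finally show "prob (\<Inter>j\<in>J. (\<lambda>\<omega>. (X j \<omega>, Y j \<omega>)) -` A j \<inter> space M)
          = (\<Prod>j\<in>J. prob ((\<lambda>\<omega>. (X j \<omega>, Y j \<omega>)) -` A j \<inter> space M))" .
    qed
  qed (use J in auto)
qed

lemma (in prob_space) prob_inter_of_indep_rvs:
  assumes XY: "indep_rvs M (PiM I (\<lambda>_. T)) (\<lambda>\<omega>. \<lambda>i\<in>I. Y i \<omega>) (PiM I (\<lambda>_. S)) (\<lambda>\<omega>. \<lambda>i\<in>I. X i \<omega>)"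
    and i: "i \<in> I" and C: "C \<in> sets S" and D: "D \<in> sets T"
  shows "prob {\<omega> \<in> space M. X i \<omega> \<in> C \<and> Y i \<omega> \<in> D}
           = prob {\<omega> \<in> space M. X i \<omega> \<in> C} * prob {\<omega> \<in> space M. Y i \<omega> \<in> D}"
proof -
  have "(\<lambda>f. f i) -` D \<inter> space (PiM I (\<lambda>_. T)) \<in> sets (PiM I (\<lambda>_. T))"
    "(\<lambda>f. f i) -` C \<inter> space (PiM I (\<lambda>_. S)) \<in> sets (PiM I (\<lambda>_. S))"
    using i C D by (auto intro: measurable_sets measurable_component_singleton)
  note * = indep_rvs_prob[OF XY this]
  have "(\<lambda>\<omega>. \<lambda>i\<in>I. Y i \<omega>) \<in> measurable M (PiM I (\<lambda>_. T))"
    "(\<lambda>\<omega>. \<lambda>i\<in>I. X i \<omega>) \<in> measurable M (PiM I (\<lambda>_. S))"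
    using XY by (auto simp: indep_rvs_def)
  note sp = this[THEN measurable_space]
  let ?Y = "(\<lambda>\<omega>. \<lambda>i\<in>I. Y i \<omega>) -` ((\<lambda>f. f i) -` D \<inter> space (PiM I (\<lambda>_. T))) \<inter> space M"
  let ?X = "(\<lambda>\<omega>. \<lambda>i\<in>I. X i \<omega>) -` ((\<lambda>f. f i) -` C \<inter> space (PiM I (\<lambda>_. S))) \<inter> space M"
  have Y: "?Y = {\<omega> \<in> space M. Y i \<omega> \<in> D}" and X: "?X = {\<omega> \<in> space M. X i \<omega> \<in> C}"
    using i sp by auto
  have "{\<omega> \<in> space M. X i \<omega> \<in> C \<and> Y i \<omega> \<in> D} = ?Y \<inter> ?X"
    unfolding X Y by auto
  then show ?thesis
    using * unfolding X Y by (simp only: mult.commute)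
qed

section \<open>The bandit as a driven recursion\<close>

text \<open>
  The indicators of the arms enter as truth values (\<open>a = 1\<close>, \<open>b = 1\<close>) instead of as factors. The
  bounds below then hold for all real \<open>a\<close> and \<open>b\<close>, not just for \<open>0\<close> and \<open>1\<close>.
\<close>
definition bandit_increment :: "real \<Rightarrow> real \<Rightarrow> real \<times> real \<times> real \<Rightarrow> real" where
  "bandit_increment \<rho> x = (\<lambda>(u, a, b).
     if u \<le> x then (if a = 1 then 1 - x else - \<rho> * x)
     else (if b = 1 then - x else \<rho> * (1 - x)))"

lemma bandit_increment_measurable [measurable]:
  "case_prod (bandit_increment \<rho>) \<in> borel_measurable (borel \<Otimes>\<^sub>M (borel \<Otimes>\<^sub>M borel))"
  unfolding bandit_increment_def borel_prod[symmetric] case_prod_beta by measurable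

lemma bandit_increment_bound:
  assumes "0 < \<rho>" "\<rho> \<le> 1" "x \<in> {0..1}"
  shows "\<bar>bandit_increment \<rho> x z\<bar> \<le> 1"
proof -
  have "0 \<le> \<rho> * x" "\<rho> * x \<le> 1" "0 \<le> \<rho> * (1 - x)" "\<rho> * (1 - x) \<le> 1"
    using assms by (auto intro: mult_le_one)
  then show ?thesis using assms(3) by (auto simp: bandit_increment_def split: prod.split)
qed

text \<open>
  Every move is a convex combination of \<open>x\<close> with one of the endpoints \<open>0\<close> and \<open>1\<close>, of weight \<open>c\<close>
  for a reward and \<open>c * \<rho>\<close> for a penalty.
\<close>
lemma bandit_increment_invariant:
  assumes "0 < \<rho>" "0 < c" "c < 1" "c * \<rho> < 1" "x \<in> {0..1}"
  shows "x + c * bandit_increment \<rho> x z \<in> {0..1}"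
proof -
  have *: "x + c' * (1 - x) \<in> {0..1}" "x - c' * x \<in> {0..1}" if "0 \<le> c'" "c' \<le> 1" for c'
  proof -
    have "0 \<le> c' * x" "c' * x \<le> x" "0 \<le> c' * (1 - x)" "c' * (1 - x) \<le> 1 - x"
      using that assms(5) by (auto intro: mult_left_le_one_le)
    then show "x + c' * (1 - x) \<in> {0..1}" "x - c' * x \<in> {0..1}" using assms(5) by auto
  qed
  have "x + c * bandit_increment \<rho> x z
      \<in> {x + c * (1 - x), x - c * x, x + (c * \<rho>) * (1 - x), x - (c * \<rho>) * x}"
    by (cases z) (auto simp: bandit_increment_def mult.assoc)
  then show ?thesis using *[of c] *[of "c * \<rho>"] assms by auto
qed

text \<open>
  The increment is a linear combination of the indicators of \<open>{u \<le> x}\<close>, \<open>{u \<le> x} \<inter> a\<close>, \<open>{u > x}\<close> and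
  \<open>{u > x} \<inter> b\<close>, whose probabilities are \<open>x\<close>, \<open>x pA\<close>, \<open>1 - x\<close> and \<open>(1 - x) pB\<close>. The events \<open>a\<close> and \<open>b\<close>
  never occur together in it, so only their separate probabilities enter.
\<close>
lemma (in prob_space) bandit_increment_mean:
  assumes U [measurable]: "u \<in> borel_measurable M"
    and dist: "distr M borel u = uniform_measure lborel {0..1}"
    and A [measurable]: "a \<in> events" and B [measurable]: "b \<in> events"
    and p: "prob a = pA" "prob b = pB"
    and indep: "\<And>C D. C \<in> sets borel \<Longrightarrow> D \<in> sets borel \<Longrightarrow>
      prob {\<omega> \<in> space M. u \<omega> \<in> C \<and> (indicator a \<omega>, indicator b \<omega>) \<in> D}
        = prob {\<omega> \<in> space M. u \<omega> \<in> C} * prob {\<omega> \<in> space M. (indicator a \<omega>, indicator b \<omega>) \<in> (D :: (real \<times> real) set)}"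
    and x: "x \<in> {0..1}"
  shows "expectation (\<lambda>\<omega>. bandit_increment \<rho> x (u \<omega>, indicator a \<omega>, indicator b \<omega>))
           = bandit_drift pA pB \<rho> x"
proof -
  let ?L = "{\<omega> \<in> space M. u \<omega> \<le> x}"
  have a: "a = {\<omega> \<in> space M. indicator a \<omega> = (1::real)}" and b: "b = {\<omega> \<in> space M. indicator b \<omega> = (1::real)}"
    using sets.sets_into_space[OF A] sets.sets_into_space[OF B]
    by (auto simp: indicator_def split: if_splits)
  have "measure M ?L = measure (distr M borel u) {..x}"
    by (subst measure_distr) (auto intro!: arg_cong[where f="measure M"])
  also have "\<dots> = measure lborel ({0..1} \<inter> {..x}) / measure lborel {0..1::real}"
    unfolding dist by (subst measure_uniform_measure) auto
  also have "{0..1} \<inter> {..x} = {0..x}" using x by auto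
  finally have L: "prob ?L = x" using x by simp
  have R: "prob (space M - ?L) = 1 - x" using L by (simp add: prob_compl)
  have LA: "prob (?L \<inter> a) = x * pA"
  proof -
    have "{\<omega> \<in> space M. u \<omega> \<in> {..x} \<and> (indicator a \<omega>, indicator b \<omega>) \<in> {1::real} \<times> (UNIV :: real set)} = ?L \<inter> a"
      "{\<omega> \<in> space M. (indicator a \<omega>, indicator b \<omega>) \<in> {1::real} \<times> (UNIV :: real set)} = a"
      using sets.sets_into_space[OF A] by (auto simp: indicator_def split: if_splits)
    then show ?thesis using indep[of "{..x}" "{1} \<times> UNIV"] L p
      by (simp add: borel_prod[symmetric])
  qed
  have RB: "prob ((space M - ?L) \<inter> b) = (1 - x) * pB"
  proof -
    have "{\<omega> \<in> space M. u \<omega> \<in> {x<..} \<and> (indicator a \<omega>, indicator b \<omega>) \<in> (UNIV :: real set) \<times> {1::real}} = (space M - ?L) \<inter> b"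
      "{\<omega> \<in> space M. (indicator a \<omega>, indicator b \<omega>) \<in> (UNIV :: real set) \<times> {1::real}} = b"
      "{\<omega> \<in> space M. u \<omega> \<in> {x<..}} = space M - ?L"
      using sets.sets_into_space[OF B] by (auto simp: indicator_def split: if_splits)
    then show ?thesis using indep[of "{x<..}" "UNIV \<times> {1}"] R p
      by (simp add: borel_prod[symmetric])
  qed
  have "expectation (\<lambda>\<omega>. bandit_increment \<rho> x (u \<omega>, indicator a \<omega>, indicator b \<omega>))
      = expectation (\<lambda>\<omega>. (1 - x + \<rho> * x) * indicator (?L \<inter> a) \<omega> - \<rho> * x * indicator ?L \<omega>
          - (x + \<rho> * (1 - x)) * indicator ((space M - ?L) \<inter> b) \<omega> + \<rho> * (1 - x) * indicator (space M - ?L) \<omega>)"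
    by (intro Bochner_Integration.integral_cong refl) (auto simp: bandit_increment_def indicator_def algebra_simps)
  also have "\<dots> = (1 - x + \<rho> * x) * prob (?L \<inter> a) - \<rho> * x * prob ?L
      - (x + \<rho> * (1 - x)) * prob ((space M - ?L) \<inter> b) + \<rho> * (1 - x) * prob (space M - ?L)"
    by (simp add: emeasure_eq_measure)
  also have "\<dots> = bandit_drift pA pB \<rho> x"
    unfolding L R LA RB bandit_drift_def by algebra
  finally show ?thesis .
qed

lemma bandit_Suc:
  "bandit \<gamma> (\<lambda>_. \<rho>) U A B x (Suc n) \<omega> = bandit \<gamma> (\<lambda>_. \<rho>) U A B x n \<omega>
     + \<gamma> (Suc n) * bandit_increment \<rho> (bandit \<gamma> (\<lambda>_. \<rho>) U A B x n \<omega>)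
         (U (Suc n) \<omega>, arm_indicators A B (Suc n) \<omega>)"
  by (simp add: Let_def bandit_increment_def arm_indicators_def indicator_def)

section \<open>Almost sure convergence\<close>

theorem proposition1:
  fixes M :: "'a measure"
    and pA pB \<rho> x :: real
    and \<gamma> :: "nat \<Rightarrow> real"
    and U :: "nat \<Rightarrow> 'a \<Rightarrow> real"
    and A B :: "nat \<Rightarrow> 'a set"
  assumes "prob_space M"
    and "0 < pB" and "pB \<le> pA" and "pA < 1"
    and "antimono_on {1..} \<gamma>"
    and "\<And>n. n \<ge> 1 \<Longrightarrow> 0 < \<gamma> n"
    and "\<And>n. n \<ge> 1 \<Longrightarrow> \<gamma> n < 1"
    and "filterlim (\<lambda>N. \<Sum>n=1..N. \<gamma> n) at_top sequentially"
    and "\<And>\<theta>. \<theta> > 0 \<Longrightarrow> summable (\<lambda>n. exp (- \<theta> / \<gamma> (Suc n)))"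
    and "0 < \<rho>" and "\<rho> \<le> 1"
    and "\<And>n. n \<ge> 1 \<Longrightarrow> \<gamma> n * \<rho> < 1"
    and "prob_space.indep_vars M (\<lambda>_. borel) U {1..}"
    and "\<And>n. n \<ge> 1 \<Longrightarrow> distr M borel (U n) = uniform_measure lborel {0..1}"
    and "\<And>n. n \<ge> 1 \<Longrightarrow> A n \<in> sets M"
    and "\<And>n. n \<ge> 1 \<Longrightarrow> B n \<in> sets M"
    and "\<And>n. n \<ge> 1 \<Longrightarrow> measure M (A n) = pA"
    and "\<And>n. n \<ge> 1 \<Longrightarrow> measure M (B n) = pB"
    and "prob_space.indep_vars M (\<lambda>_. borel) (arm_indicators A B) {1..}"
    and "indep_rvs M
           (PiM {1..} (\<lambda>_. borel)) (\<lambda>\<omega>. \<lambda>n\<in>{1..}. arm_indicators A B n \<omega>)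
           (PiM {1..} (\<lambda>_. borel)) (\<lambda>\<omega>. \<lambda>n\<in>{1..}. U n \<omega>)"
    and "0 < x" and "x < 1"
  shows "(\<exists>!z. z \<in> {0<..<1} \<and> bandit_drift pA pB \<rho> z = 0) \<and>
    (AE \<omega> in M. (\<lambda>n. bandit \<gamma> (\<lambda>_. \<rho>) U A B x n \<omega>)
       \<longlonglongrightarrow> (THE z. z \<in> {0<..<1} \<and> bandit_drift pA pB \<rho> z = 0))"
proof -
  interpret prob_space M by fact
  note param = assms(2-4,10,11)
  \<comment> \<open>the step from time \<open>i\<close> to \<open>Suc i\<close> uses the data of index \<open>Suc i\<close>\<close>
  define g where "g i = \<gamma> (Suc i)" for i
  define Z where "Z i \<omega> = (U (Suc i) \<omega>, arm_indicators A B (Suc i) \<omega>)" for i \<omega>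
  have g_pos: "0 < g n" and g_less: "g n < 1" for n
    using assms(6)[of "Suc n"] assms(7)[of "Suc n"] by (simp_all add: g_def)
  have g_dec: "antimono g"
    using assms(5) by (auto simp: g_def monotone_on_def intro!: antimonoI)
  have g_div: "filterlim (\<lambda>n. \<Sum>i<n. g i) at_top sequentially"
    using assms(8) by (simp add: g_def sum.atLeast1_atMost_eq)
  have g_exp: "summable (\<lambda>n. exp (- \<theta> / g n))" if "\<theta> > 0" for \<theta>
    using assms(9)[OF that] by (simp add: g_def)
  have g_lim: "g \<longlonglongrightarrow> 0"
  proof (rule order_tendstoI)
    fix e :: real assume "0 < e"
    \<comment> \<open>a summable \<open>exp (- 1 / g n)\<close> tends to \<open>0\<close>, which forces \<open>g n\<close> to do so\<close>
    have "(\<lambda>n. exp (- 1 / g n)) \<longlonglongrightarrow> 0"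
      by (rule summable_LIMSEQ_zero[OF g_exp]) simp
    then have "\<forall>\<^sub>F n in sequentially. exp (- 1 / g n) < exp (- 1 / e)"
      by (rule order_tendstoD) simp
    then show "\<forall>\<^sub>F n in sequentially. g n < e"
    proof eventually_elim
      case (elim n)
      then show ?case using g_pos[of n] \<open>0 < e\<close> by (simp add: field_simps)
    qed
  next
    fix e :: real assume "e < 0"
    then show "\<forall>\<^sub>F n in sequentially. e < g n"
      by (intro always_eventually allI less_trans[OF _ g_pos])
  qed
  have Z_indep: "indep_vars (\<lambda>_. borel \<Otimes>\<^sub>M borel) Z {..n}" for n
  proof -
    have "indep_vars (\<lambda>_. borel \<Otimes>\<^sub>M borel) (\<lambda>i \<omega>. (U i \<omega>, arm_indicators A B i \<omega>)) (Suc ` {..n})"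
      by (rule indep_vars_Pair[OF assms(13,19,20)]) auto
    \<comment> \<open>shift the index set by passing through singleton blocks\<close>
    then have "indep_vars (\<lambda>j. PiM {Suc j} (\<lambda>_. borel \<Otimes>\<^sub>M borel))
        (\<lambda>j \<omega>. \<lambda>i\<in>{Suc j}. (U i \<omega>, arm_indicators A B i \<omega>)) {..n}"
      by (rule indep_vars_restrict) (auto simp: disjoint_family_on_def)
    from indep_vars_compose2[OF this, of "\<lambda>j f. f (Suc j)" "\<lambda>_. borel \<Otimes>\<^sub>M borel"]
    show ?thesis
      unfolding Z_def by (simp add: measurable_component_singleton)
  qed
  have Z_mean: "expectation (\<lambda>\<omega>. bandit_increment \<rho> y (Z n \<omega>)) = bandit_drift pA pB \<rho> y"
    if "y \<in> {0..1}" for y n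
    unfolding Z_def arm_indicators_def
  proof (rule bandit_increment_mean)
    show "random_variable borel (U (Suc n))"
      using assms(13) by (auto simp: indep_vars_def)
    show "prob {\<omega> \<in> space M. U (Suc n) \<omega> \<in> C \<and> (indicator (A (Suc n)) \<omega>, indicator (B (Suc n)) \<omega>) \<in> D}
        = prob {\<omega> \<in> space M. U (Suc n) \<omega> \<in> C}
          * prob {\<omega> \<in> space M. (indicator (A (Suc n)) \<omega>, indicator (B (Suc n)) \<omega>) \<in> D}"
      if "C \<in> sets borel" "D \<in> sets borel" for C and D :: "(real \<times> real) set"
      using prob_inter_of_indep_rvs[OF assms(20) _ that, of "Suc n"]
      by (simp add: arm_indicators_def)
  qed (use assms(14-18) that in auto)
  interpret R: driven_recursion M "borel \<Otimes>\<^sub>M borel" Z "bandit_increment \<rho>" "bandit_drift pA pB \<rho>" g x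
  proof
    show "bandit_drift pA pB \<rho> \<in> borel_measurable borel"
      unfolding bandit_drift_def by measurable
    show "y + g n * bandit_increment \<rho> y z \<in> {0..1}" if "y \<in> {0..1}" for y z n
      using that assms(10) g_pos g_less assms(12)[of "Suc n"]
      by (intro bandit_increment_invariant) (auto simp: g_def)
  qed (use Z_indep Z_mean assms bandit_increment_bound in auto)
  have bandit_eq_trajectory: "bandit \<gamma> (\<lambda>_. \<rho>) U A B x n \<omega> = R.trajectory (\<lambda>i. Z i \<omega>) n" for n \<omega>
  proof (induction n)
    case (Suc n)
    show ?case by (simp only: bandit_Suc R.trajectory.simps Suc.IH) (simp only: Z_def[of n] g_def[of n])
  qed simp
  obtain z \<kappa> K where z: "z \<in> {0<..<1}" and \<kappa>: "0 < \<kappa>"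
    and rev: "\<And>y. y \<in> {0..1} \<Longrightarrow> \<exists>k\<in>{\<kappa>..K}. bandit_drift pA pB \<rho> y = - k * (y - z)"
    using bandit_drift_mean_reversion[OF param] by blast
  have root: "y \<in> {0<..<1} \<and> bandit_drift pA pB \<rho> y = 0 \<longleftrightarrow> y = z" for y
    using rev[of y] rev[of z] z \<kappa> by force
  have "AE \<omega> in M. \<forall>m. \<forall>\<^sub>F j in sequentially.
      \<bar>block_noise (bandit_drift pA pB \<rho>) g (inverse (Suc m)) (R.trajectory (\<lambda>i. Z i \<omega>)) j\<bar>
        \<le> (inverse (Suc m))\<^sup>2"
    unfolding AE_all_countable
    using g_pos g_less g_dec g_div g_exp
    by (intro allI R.AE_block_noise_small) (auto simp: less_imp_le)
  then have "AE \<omega> in M. R.trajectory (\<lambda>i. Z i \<omega>) \<longlonglongrightarrow> z"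
  proof eventually_elim
    case (elim \<omega>)
    let ?X = "R.trajectory (\<lambda>i. Z i \<omega>)"
    have step: "\<bar>?X (Suc n) - ?X n\<bar> \<le> g n" for n
      using R.F_bound[OF R.trajectory_in_unit] g_pos[of n] by (simp add: abs_mult mult_le_cancel_left1)
    show ?case
      by (rule mean_reverting_recursion_tendsto[where S="{0..1}" and L=4, OF less_imp_le[OF g_pos]
            g_lim g_div R.trajectory_in_unit step bandit_drift_lipschitz[OF param] _ \<kappa> rev])
         (use elim in auto)
  qed
  moreover have "(THE y. y \<in> {0<..<1} \<and> bandit_drift pA pB \<rho> y = 0) = z"
    by (simp only: root the_eq_trivial)
  ultimately show ?thesis
    unfolding bandit_eq_trajectory root by simp
qed

end
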